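(* Let $\mathcal{B}=\langle B,\wedge,\vee,\neg,0,1\rangle$ be a Boolean algebra and $\mathbf{G},\mathbf{H},\mathbf{F},\mathbf{P}$ unary operators on $B$. Then $\langle\mathcal{B},\mathbf{G},\mathbf{H},\mathbf{F},\mathbf{P}\rangle$ is a tense algebra if and only if $\langle B,\wedge,\vee,0,1,\mathbf{G},\mathbf{H},\mathbf{F},\mathbf{P}\rangle$ is a $\mathbf{tDL}$-algebra.
   Context: A $\mathbf{tDL}$-algebra is a bounded distributive lattice $\langle A,\wedge,\vee,0,1\rangle$ with unary operators $\mathbf{G},\mathbf{H},\mathbf{F},\mathbf{P}$ such that for all $x,y$: (t1) $\mathbf{G}1=\mathbf{H}1=1$; (t2) $\mathbf{G}(x\wedge y)=\mathbf{G}x\wedge\mathbf{G}y$, $\mathbf{H}(x\wedge y)=\mathbf{H}x\wedge\mathbf{H}y$; (t3) $x\le\mathbf{G}\mathbf{P}x$, $x\le\mathbf{H}\mathbf{F}x$; (t4) $\mathbf{G}(x\vee y)\le\mathbf{G}x\vee\mathbf{F}y$, $\mathbf{H}(x\vee y)\le\mathbf{H}x\vee\mathbf{P}y$; (t5) $\mathbf{F}0=\mathbf{P}0=0$; (t6) $\mathbf{F}(x\vee y)=\mathbf{F}x\vee\mathbf{F}y$, $\mathbf{P}(x\vee y)=\mathbf{P}x\vee\mathbf{P}y$; (t7) $\mathbf{P}\mathbf{G}x\le x$, $\mathbf{F}\mathbf{H}x\le x$; (t8) $\mathbf{G}x\wedge\mathbf{F}y\le\mathbf{F}(x\wedge y)$,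 $\mathbf{H}x\wedge\mathbf{P}y\le\mathbf{P}(x\wedge y)$. A tense algebra, written in the signature with all four operators, is a Boolean algebra with unary operators $\mathbf{G},\mathbf{H},\mathbf{F},\mathbf{P}$ such that $\mathbf{G},\mathbf{H}$ satisfy (t1), (t2), (t3) and $\mathbf{F}x=\neg\mathbf{G}\neg x$, $\mathbf{P}x=\neg\mathbf{H}\neg x$ for all $x$. *)

theory Defs
  imports Main
begin

text \<open>
  The lattice and Boolean reducts are the type-class structures on the carrier type; the classes
  do not require bot and top to be distinct, so the one-element algebra is included.
\<close>

locale tDL_algebra =
  fixes G H F P :: "'a::{distrib_lattice, bounded_lattice} \<Rightarrow> 'a"
  assumes t1_G: "G top = top" and t1_H: "H top = top"
    and t2_G: "G (inf x y) = inf (G x) (G y)" and t2_H: "H (inf x y) = inf (H x) (H y)"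
    and t3_GP: "x \<le> G (P x)" and t3_HF: "x \<le> H (F x)"
    and t4_G: "G (sup x y) \<le> sup (G x) (F y)" and t4_H: "H (sup x y) \<le> sup (H x) (P y)"
    and t5_F: "F bot = bot" and t5_P: "P bot = bot"
    and t6_F: "F (sup x y) = sup (F x) (F y)" and t6_P: "P (sup x y) = sup (P x) (P y)"
    and t7_PG: "P (G x) \<le> x" and t7_FH: "F (H x) \<le> x"
    and t8_F: "inf (G x) (F y) \<le> F (inf x y)" and t8_P: "inf (H x) (P y) \<le> P (inf x y)"

locale tense_algebra =
  fixes G H F P :: "'a::boolean_algebra \<Rightarrow> 'a"
  assumes t1_G: "G top = top" and t1_H: "H top = top"
    and t2_G: "G (inf x y) = inf (G x) (G y)" and t2_H: "H (inf x y) = inf (H x) (H y)"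
    and t3_GP: "x \<le> G (P x)" and t3_HF: "x \<le> H (F x)"
    and F_eq: "F x = - G (- x)" and P_eq: "P x = - H (- x)"

end

theory Submission
  imports Defs
begin

text \<open>
  In a Boolean algebra, (t4) and (t8) at a complementary pair say \<open>G (- x) \<squnion> F x = \<top>\<close> and
  \<open>G (- x) \<sqinter> F x = \<bottom>\<close>, so \<open>F x\<close> is the complement of \<open>G (- x)\<close>. Conversely, once \<open>F\<close> is the
  De Morgan dual of \<open>G\<close>, shunting turns (t4) and (t8) into instances of the monotonicity and
  multiplicativity of \<open>G\<close>, and (t7) is the dual of (t3).
\<close>

lemma De_Morgan_dual_sup_le:
  fixes G :: "'a::boolean_algebra \<Rightarrow> 'a"
  assumes "\<And>x y. G (inf x y) = inf (G x) (G y)"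
  shows "G (sup x y) \<le> sup (G x) (- G (- y))"
proof -
  \<comment> \<open>Both sides are \<open>G (inf x (- y))\<close>, since meeting with
    \<open>- y\<close> cancels \<open>y\<close> from the join.\<close>
  have "inf (G (sup x y)) (G (- y)) = inf (G x) (G (- y))"
    by (simp flip: assms add: inf_sup_distrib2)
  then have "inf (G (sup x y)) (G (- y)) \<le> G x"
    by simp
  then show ?thesis
    by (simp add: shunt1 sup.commute)
qed

lemma De_Morgan_dual_inf_le:
  fixes G :: "'a::boolean_algebra \<Rightarrow> 'a"
  assumes "\<And>x y. G (inf x y) = inf (G x) (G y)"
  shows "inf (G x) (- G (- y)) \<le> - G (- inf x y)"
proof -
  \<comment> \<open>Both sides are again \<open>G (inf x (- y))\<close>: below \<open>x\<close>, the
    complements of \<open>inf x y\<close> and of \<open>y\<close> agree.\<close>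
  have "inf (G x) (G (- inf x y)) = inf (G x) (G (- y))"
    by (simp flip: assms add: inf_sup_distrib1)
  then have "inf (G x) (G (- inf x y)) \<le> G (- y)"
    by simp
  then have "G x \<le> sup (- G (- inf x y)) (G (- y))"
    by (simp only: shunt1)
  then show ?thesis
    by (simp add: shunt1 sup.commute)
qed

lemma De_Morgan_dual_unique:
  fixes G F :: "'a::boolean_algebra \<Rightarrow> 'a"
  assumes "G top = top" "F bot = bot"
    and sup_le: "\<And>x y. G (sup x y) \<le> sup (G x) (F y)"
    and inf_le: "\<And>x y. inf (G x) (F y) \<le> F (inf x y)"
  shows "F x = - G (- x)"
proof -
  have "inf (G (- x)) (F x) = bot"
    using inf_le[of "- x" x] assms(2) by (simp add: bot_unique)
  moreover have "sup (G (- x)) (F x) = top"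
    using sup_le[of "- x" x] assms(1) by (simp add: top_unique)
  ultimately show ?thesis
    by (metis compl_unique)
qed

theorem theorem2p16:
  fixes G H F P :: "'a::boolean_algebra \<Rightarrow> 'a"
  shows "tense_algebra G H F P \<longleftrightarrow> tDL_algebra G H F P"
proof
  assume "tense_algebra G H F P"
  then interpret tense_algebra G H F P .
  show "tDL_algebra G H F P"
  proof
    fix x y
    show "G (sup x y) \<le> sup (G x) (F y)" "H (sup x y) \<le> sup (H x) (P y)"
      unfolding F_eq P_eq by (intro De_Morgan_dual_sup_le t2_G t2_H)+
    show "inf (G x) (F y) \<le> F (inf x y)" "inf (H x) (P y) \<le> P (inf x y)"
      unfolding F_eq P_eq by (intro De_Morgan_dual_inf_le t2_G t2_H)+
    \<comment> \<open>The two adjunctions swap: as \<open>F (- x) = - G x\<close>, (t3) for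
      \<open>H\<close> gives \<open>- x \<le> H (- G x)\<close>, and complementing yields the
      claim.\<close>
    show "P (G x) \<le> x"
      using t3_HF[of "- x"] by (simp add: F_eq P_eq compl_le_swap2)
    show "F (H x) \<le> x"
      using t3_GP[of "- x"] by (simp add: F_eq P_eq compl_le_swap2)
  \<comment> \<open>(t3) is closed while \<open>F\<close> and \<open>P\<close> are still folded;
    unfolding them then reduces (t5) and (t6) to (t1) and (t2).\<close>
  qed (simp_all add: t1_G t1_H t2_G t2_H t3_GP t3_HF, simp_all add: F_eq P_eq t1_G t1_H t2_G t2_H)
next
  assume "tDL_algebra G H F P"
  then interpret tDL_algebra G H F P .
  show "tense_algebra G H F P"
  proof
    fix x
    show "F x = - G (- x)"
      by (rule De_Morgan_dual_unique[OF t1_G t5_F t4_G t8_F])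
    show "P x = - H (- x)"
      by (rule De_Morgan_dual_unique[OF t1_H t5_P t4_H t8_P])
  qed (simp_all add: t1_G t1_H t2_G t2_H t3_GP t3_HF)
qed

end
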